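(* Let $G$ be a finite $d$-regular graph on $n$ vertices that is a $\gamma$-spreader for some $\gamma>0$. Then for all $i>1$, $\lambda_i(G)^2\le d^2-\frac{\gamma^2}{4+2\gamma^2}$.
   Context: Graphs may have multiple edges and self-loops. For a set $A$ of vertices, $\Gamma(A)$ is the set of vertices joined by an edge to some member of $A$. $G$ is a $\gamma$-spreader if $|\Gamma(A)|\ge(1+\gamma)|A|$ for every set $A$ of at most $n/2$ vertices. $\lambda_1(G)\ge\cdots\ge\lambda_n(G)$ are the adjacency eigenvalues. *)

theory Defs
  imports
    "HOL-Library.Multiset"
    "HOL-Library.Uprod"
    "Jordan_Normal_Form.Char_Poly"
begin

text \<open>
  A finite graph, with multiple edges and self-loops allowed, is a finite vertex set \<open>V\<close>
  together with a multiset \<open>E\<close> of unordered pairs of (not necessarily distinct) vertices.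
\<close>

locale multigraph =
  fixes V :: "'a set" and E :: "'a uprod multiset"
  assumes finite_verts: "finite V"
    and edges_wf: "e \<in># E \<Longrightarrow> set_uprod e \<subseteq> V"

text \<open>
  The adjacency matrix entry at \<open>(u, v)\<close>. A loop counts once, both here and in the degree,
  so that degrees are the row sums of the adjacency matrix. The convention in which a loop
  counts twice (in both places) is obtained by putting each loop into \<open>E\<close> twice, which does
  not affect \<open>nbrs\<close>.
\<close>

definition edge_mult :: "'a uprod multiset \<Rightarrow> 'a \<Rightarrow> 'a \<Rightarrow> nat" where
  "edge_mult E u v = count E (Upair u v)"

definition degree_of :: "'a set \<Rightarrow> 'a uprod multiset \<Rightarrow> 'a \<Rightarrow> nat" where
  "degree_of V E u = (\<Sum>v\<in>V. edge_mult E u v)"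

definition regular :: "'a set \<Rightarrow> 'a uprod multiset \<Rightarrow> nat \<Rightarrow> bool" where
  "regular V E d \<longleftrightarrow> (\<forall>u\<in>V. degree_of V E u = d)"

text \<open>\<open>nbrs E A\<close> is $\Gamma(A)$; it may contain members of \<open>A\<close>.\<close>

definition nbrs :: "'a uprod multiset \<Rightarrow> 'a set \<Rightarrow> 'a set" where
  "nbrs E A = {v. \<exists>u\<in>A. Upair u v \<in># E}"

definition spreader :: "'a set \<Rightarrow> 'a uprod multiset \<Rightarrow> real \<Rightarrow> bool" where
  "spreader V E \<gamma> \<longleftrightarrow>
     (\<forall>A\<subseteq>V. real (card A) \<le> real (card V) / 2 \<longrightarrow>
        real (card (nbrs E A)) \<ge> (1 + \<gamma>) * real (card A))"

text \<open>
  Matrices are indexed by \<open>{0..<n}\<close>, so an enumeration of the vertices is chosen; the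
  characteristic polynomial does not depend on the choice.
\<close>

definition vertex_list :: "'a set \<Rightarrow> 'a list" where
  "vertex_list V = (SOME vs. distinct vs \<and> set vs = V)"

definition adj_matrix :: "'a set \<Rightarrow> 'a uprod multiset \<Rightarrow> real mat" where
  "adj_matrix V E = mat (card V) (card V)
     (\<lambda>(i, j). real (edge_mult E (vertex_list V ! i) (vertex_list V ! j)))"

text \<open>
  The eigenvalues with multiplicity, in decreasing order. The matrix being real symmetric, its
  characteristic polynomial splits over the reals, so for a multigraph this list has length
  \<open>card V\<close>.
\<close>

definition adj_eigenvalues :: "'a set \<Rightarrow> 'a uprod multiset \<Rightarrow> real list" where
  "adj_eigenvalues V E = rev (sorted_list_of_multiset (proots (char_poly (adj_matrix V E))))"

text \<open>The $i$-th largest eigenvalue, for \<open>1 \<le> i \<le> card V\<close>.\<close>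

definition adj_eigenvalue :: "'a set \<Rightarrow> 'a uprod multiset \<Rightarrow> nat \<Rightarrow> real" where
  "adj_eigenvalue V E i = adj_eigenvalues V E ! (i - 1)"

end

theory Submission
  imports Defs "Jordan_Normal_Form.Schur_Decomposition"
begin

text \<open>
  Let \<open>f\<close> be an eigenfunction of the adjacency operator \<open>A\<close> orthogonal to the constants, with
  eigenvalue \<open>\<mu>\<close>, and let \<open>g\<close> be its positive part; after a change of sign \<open>g\<close> is supported on at
  most half of the vertices. Since \<open>A\<close> is nonnegative, \<open>A\<^sup>2 g \<ge> \<mu>\<^sup>2 f\<close> pointwise, hence
  \<open>\<parallel>A g\<parallel>\<^sup>2 \<ge> \<mu>\<^sup>2 \<parallel>g\<parallel>\<^sup>2\<close>. On the other hand let \<open>k = A g / d\<close>, and let \<open>M y\<close> be the maximum of \<open>g\<close> over the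
  neighbours of \<open>y\<close>. Spreading, applied to the level sets of \<open>g\<close>, gives
  \<open>\<parallel>M\<parallel>\<^sup>2 \<ge> (1 + \<gamma>) \<parallel>g\<parallel>\<^sup>2\<close>, so \<open>M\<close> is far from \<open>k\<close>, while
  \<open>d\<^sup>2 \<parallel>g\<parallel>\<^sup>2 - \<parallel>A g\<parallel>\<^sup>2 = d \<Sum> A\<^sub>x\<^sub>y (g x - k y)\<^sup>2 \<ge> d \<parallel>M - k\<parallel>\<^sup>2\<close>. This replaces the usual network flow
  argument; its slightly worse constant is compensated by \<open>d \<ge> 2\<close>.

  If \<open>\<lambda>\<^sub>i = d\<close> for some \<open>i > 1\<close>, then \<open>\<lambda>\<^sub>1 = \<lambda>\<^sub>2 = d\<close>, as a larger eigenvalue would contradict the bound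
  just described. A Schur form beginning with \<open>d, d\<close> then gives two independent eigenfunctions for
  \<open>d\<close>, and a combination of them is orthogonal to the constants.
\<close>

section \<open>Comparing sums through level sets\<close>

text \<open>A discrete layer-cake argument: a layer whose height is the least positive value of
  \<open>a\<close> is cut off both functions, and induction on the size of the support of
  \<open>a\<close> handles the rest.\<close>

lemma sum_le_of_card_level_sets:
  fixes a :: "'a \<Rightarrow> real" and b :: "'b \<Rightarrow> real" and c :: real
  assumes "finite A" "finite B"
    and "\<And>x. x \<in> A \<Longrightarrow> 0 \<le> a x" and "\<And>y. y \<in> B \<Longrightarrow> 0 \<le> b y"
    and "\<And>t. 0 < t \<Longrightarrow> c * real (card {x\<in>A. t \<le> a x}) \<le> real (card {y\<in>B. t \<le> b y})"
  shows "c * sum a A \<le> sum b B"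
  using assms(3-)
proof (induction "card {x\<in>A. 0 < a x}" arbitrary: a b rule: less_induct)
  case less
  let ?S = "{x\<in>A. 0 < a x}"
  show ?case
  proof (cases "?S = {}")
    case True
    then have "\<And>x. x \<in> A \<Longrightarrow> a x = 0" using less.prems(1) by force
    then have "sum a A = 0" by simp
    moreover have "0 \<le> sum b B" using less.prems(2) by (intro sum_nonneg)
    ultimately show ?thesis by simp
  next
    case False
    define m where "m = Min (a ` ?S)"
    have fin: "finite (a ` ?S)" using assms(1) by simp
    have "m \<in> a ` ?S" unfolding m_def using fin False by (intro Min_in) auto
    then obtain x0 where x0: "x0 \<in> A" "0 < a x0" "m = a x0" by auto
    have m_le: "m \<le> a x" if "x \<in> A" "0 < a x" for x
      unfolding m_def using fin that by (intro Min_le) auto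
    have m0: "0 < m" using x0 by simp
    \<comment> \<open>Level sets of the truncations at \<open>t\<close> are level sets of
      \<open>a\<close> and \<open>b\<close> at \<open>t + m\<close>, so the hypothesis is inherited;
      \<open>x0\<close> leaves the support of \<open>a\<close>.\<close>
    define a' b' where "a' = (\<lambda>x. max (a x - m) 0)" and "b' = (\<lambda>y. max (b y - m) 0)"
    have "x0 \<in> ?S - {x\<in>A. 0 < a' x}" "{x\<in>A. 0 < a' x} \<subseteq> ?S"
      using x0 m0 by (auto simp: a'_def)
    then have "{x\<in>A. 0 < a' x} \<subset> ?S" by blast
    then have "card {x\<in>A. 0 < a' x} < card ?S"
      using assms(1) by (intro psubset_card_mono) auto
    then have IH: "c * sum a' A \<le> sum b' B"
    proof (rule less.hyps)
      fix t :: real assume "0 < t"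
      then have "{x\<in>A. t \<le> a' x} = {x\<in>A. t + m \<le> a x}" "{x\<in>B. t \<le> b' x} = {x\<in>B. t + m \<le> b x}"
        by (auto simp: a'_def b'_def)
      then show "c * real (card {x\<in>A. t \<le> a' x}) \<le> real (card {y\<in>B. t \<le> b' y})"
        using less.prems(3)[of "t + m"] \<open>0 < t\<close> m0 by simp
    qed (auto simp: a'_def b'_def)
    have count: "real (card {x\<in>C. P x}) * m = (\<Sum>x\<in>C. if P x then m else 0)"
      if "finite C" for P and C :: "'z set"
      using that by (simp add: sum.If_cases Int_def)
    \<comment> \<open>Exact because \<open>a\<close> takes no value strictly between 0 and
      \<open>m\<close>. For \<open>b\<close> such values may occur and are dropped, which only helps
      an upper bound by \<open>sum b B\<close>.\<close>
    have "a x = a' x + (if m \<le> a x then m else 0)" if "x \<in> A" for x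
      using m_le[OF that] less.prems(1)[OF that] m0 by (cases "0 < a x") (auto simp: a'_def)
    then have "sum a A = sum a' A + real (card {x\<in>A. m \<le> a x}) * m"
      using assms(1) by (simp add: count sum.distrib[symmetric])
    then have "c * sum a A = c * sum a' A + (c * real (card {x\<in>A. m \<le> a x})) * m"
      by (simp add: algebra_simps)
    also have "\<dots> \<le> sum b' B + real (card {x\<in>B. m \<le> b x}) * m"
      using IH less.prems(3)[OF m0] m0 by (intro add_mono mult_right_mono) auto
    also have "\<dots> = (\<Sum>y\<in>B. b' y + (if m \<le> b y then m else 0))"
      using assms(2) by (simp add: count sum.distrib)
    also have "\<dots> \<le> sum b B"
      using less.prems(2) by (intro sum_mono) (auto simp: b'_def)
    finally show ?thesis .
  qed
qed

section \<open>Spreading and the adjacency operator\<close>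

lemma edge_mult_commute: "edge_mult E u v = edge_mult E v u"
  by (metis edge_mult_def Upair_inject)

context multigraph
begin

lemma nbrs_subset: "nbrs E A \<subseteq> V"
  using edges_wf by (fastforce simp: nbrs_def)

lemma card_nbrs_singleton_le:
  assumes "regular V E d" "v \<in> V"
  shows "card (nbrs E {v}) \<le> d"
proof -
  have "card (nbrs E {v}) = (\<Sum>w\<in>nbrs E {v}. 1)" by simp
  also have "\<dots> \<le> (\<Sum>w\<in>nbrs E {v}. edge_mult E v w)"
    by (intro sum_mono) (auto simp: nbrs_def edge_mult_def Suc_le_eq)
  also have "\<dots> \<le> (\<Sum>w\<in>V. edge_mult E v w)"
    using nbrs_subset finite_verts by (intro sum_mono2) auto
  also have "\<dots> = d" using assms by (simp add: regular_def degree_of_def)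
  finally show ?thesis .
qed

text \<open>For \<open>t > 0\<close> the level set of \<open>g\<close> squared lies in the support
  of \<open>g\<close>, hence is small enough to spread, and its neighbours all lie in the level set
  of \<open>M\<close> squared at the same \<open>t\<close>.\<close>

lemma sum_sqr_neighbour_max_ge:
  assumes "spreader V E \<gamma>"
    and "\<And>x. x \<in> V \<Longrightarrow> 0 \<le> g x" and "2 * card {x\<in>V. 0 < g x} \<le> card V"
    and "\<And>x y. x \<in> V \<Longrightarrow> Upair x y \<in># E \<Longrightarrow> g x \<le> M y"
  shows "(1 + \<gamma>) * (\<Sum>x\<in>V. (g x)\<^sup>2) \<le> (\<Sum>y\<in>V. (M y :: real)\<^sup>2)"
proof (rule sum_le_of_card_level_sets)
  fix t :: real assume t: "0 < t"
  let ?L = "{x\<in>V. t \<le> (g x)\<^sup>2}"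
  have "?L \<subseteq> {x\<in>V. 0 < g x}" using assms(2) t by (force simp: order.order_iff_strict)
  then have "card ?L \<le> card {x\<in>V. 0 < g x}" using finite_verts by (intro card_mono) auto
  then have "real (card ?L) \<le> real (card V) / 2" using assms(3) by linarith
  then have "(1 + \<gamma>) * real (card ?L) \<le> real (card (nbrs E ?L))"
    using assms(1) by (simp add: spreader_def)
  also have "nbrs E ?L \<subseteq> {y\<in>V. t \<le> (M y)\<^sup>2}"
  proof
    fix y assume "y \<in> nbrs E ?L"
    then obtain x where x: "x \<in> V" "t \<le> (g x)\<^sup>2" "Upair x y \<in># E" by (auto simp: nbrs_def)
    then have "(g x)\<^sup>2 \<le> (M y)\<^sup>2" using assms by (intro power_mono) auto
    then show "y \<in> {y\<in>V. t \<le> (M y)\<^sup>2}" using x \<open>y \<in> nbrs E ?L\<close> nbrs_subset by auto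
  qed
  then have "card (nbrs E ?L) \<le> card {y\<in>V. t \<le> (M y)\<^sup>2}" using finite_verts by (intro card_mono) auto
  finally show "(1 + \<gamma>) * real (card ?L) \<le> real (card {y\<in>V. t \<le> (M y)\<^sup>2})" by simp
qed (use finite_verts in auto)

text \<open>With at least two vertices a singleton is small enough to spread, so it has more than
  one neighbour.\<close>

lemma spreader_degree_ge_2:
  assumes "regular V E d" "\<gamma> > 0" "spreader V E \<gamma>" "2 \<le> card V"
  shows "2 \<le> d"
proof -
  obtain v where v: "v \<in> V" using assms(4) by fastforce
  have "{v} \<subseteq> V \<Longrightarrow> real (card {v}) \<le> real (card V) / 2 \<Longrightarrow>
      (1 + \<gamma>) * real (card {v}) \<le> real (card (nbrs E {v}))"
    using assms(3) unfolding spreader_def by blast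
  then have "1 + \<gamma> \<le> real (card (nbrs E {v}))" using v assms(4) by simp
  moreover have "real (card (nbrs E {v})) \<le> real d" using card_nbrs_singleton_le[OF assms(1) v] by simp
  ultimately show ?thesis using assms(2) by linarith
qed

abbreviation adj_op :: "('a \<Rightarrow> real) \<Rightarrow> 'a \<Rightarrow> real" where
  "adj_op f u \<equiv> (\<Sum>v\<in>V. real (edge_mult E u v) * f v)"

lemma adj_op_symmetric: "(\<Sum>u\<in>V. f u * adj_op g u) = (\<Sum>u\<in>V. adj_op f u * g u)"
proof -
  have "(\<Sum>u\<in>V. f u * adj_op g u) = (\<Sum>u\<in>V. \<Sum>v\<in>V. real (edge_mult E u v) * f u * g v)"
    by (simp add: sum_distrib_left mult_ac)
  also have "\<dots> = (\<Sum>v\<in>V. \<Sum>u\<in>V. real (edge_mult E v u) * f u * g v)"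
    by (subst sum.swap) (simp add: edge_mult_commute)
  finally show ?thesis by (simp add: sum_distrib_right)
qed

lemma adj_op_mono:
  assumes "\<And>v. v \<in> V \<Longrightarrow> f v \<le> g v"
  shows "adj_op f u \<le> adj_op g u"
  using assms by (intro sum_mono mult_left_mono) auto

lemma row_sum:
  assumes "regular V E d" "u \<in> V"
  shows "(\<Sum>v\<in>V. real (edge_mult E u v)) = real d"
  using assms by (simp add: regular_def degree_of_def flip: of_nat_sum)

text \<open>\<open>k y\<close> is the mean of \<open>g\<close> over the edges at \<open>y\<close>,
  so each inner sum is a variance: mean square minus squared mean, times \<open>d\<close>. Symmetry
  of the operator turns the mean squares into the sum of squares of \<open>g\<close>.\<close>

lemma energy_identity:
  assumes "regular V E d" and "\<And>y. y \<in> V \<Longrightarrow> adj_op g y = real d * k y"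
  shows "(\<Sum>y\<in>V. \<Sum>x\<in>V. real (edge_mult E y x) * (g x - k y)\<^sup>2)
    = real d * ((\<Sum>x\<in>V. (g x)\<^sup>2) - (\<Sum>y\<in>V. (k y)\<^sup>2))"
proof -
  have inner: "(\<Sum>x\<in>V. real (edge_mult E y x) * (g x - k y)\<^sup>2)
      = adj_op (\<lambda>x. (g x)\<^sup>2) y - real d * (k y)\<^sup>2" if "y \<in> V" for y
  proof -
    have "(\<Sum>x\<in>V. real (edge_mult E y x) * (g x - k y)\<^sup>2)
       = adj_op (\<lambda>x. (g x)\<^sup>2) y - 2 * k y * adj_op g y + (\<Sum>x\<in>V. real (edge_mult E y x)) * (k y)\<^sup>2"
      by (simp add: power2_diff algebra_simps sum.distrib sum_subtractf sum_distrib_left)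
    then show ?thesis
      using assms(2)[OF that] row_sum[OF assms(1) that] by (simp add: power2_eq_square)
  qed
  have "(\<Sum>y\<in>V. adj_op (\<lambda>x. (g x)\<^sup>2) y) = (\<Sum>y\<in>V. real d * (g y)\<^sup>2)"
    using adj_op_symmetric[of "\<lambda>_. 1" "\<lambda>x. (g x)\<^sup>2"] row_sum[OF assms(1)] by simp
  then show ?thesis
    by (simp add: inner sum_subtractf right_diff_distrib sum_distrib_left)
qed

lemma adj_op_contraction:
  assumes "regular V E d" "\<gamma> > 0" "spreader V E \<gamma>" "2 \<le> card V"
    and g0: "\<And>x. x \<in> V \<Longrightarrow> 0 \<le> g x" and supp: "2 * card {x\<in>V. 0 < g x} \<le> card V"
  shows "(\<Sum>y\<in>V. (adj_op g y)\<^sup>2) \<le> ((real d)\<^sup>2 - \<gamma>\<^sup>2 / (4 + 2 * \<gamma>\<^sup>2)) * (\<Sum>x\<in>V. (g x)\<^sup>2)"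
proof -
  have d2: "2 \<le> d" using assms(1-4) by (rule spreader_degree_ge_2)
  define k where "k y = adj_op g y / real d" for y
  have Ag: "adj_op g y = real d * k y" for y using d2 by (simp add: k_def)
  \<comment> \<open>The maximum over the neighbours of \<open>y\<close> is attained: there is at
    least one neighbour because the row sum \<open>d\<close> is nonzero.\<close>
  have "\<exists>x\<in>V. Upair x y \<in># E \<and> (\<forall>z\<in>V. Upair z y \<in># E \<longrightarrow> g z \<le> g x)" if y: "y \<in> V" for y
  proof -
    let ?N = "{x\<in>V. Upair x y \<in># E}"
    have "?N \<noteq> {}"
    proof
      assume "?N = {}"
      then have "\<And>x. x \<in> V \<Longrightarrow> edge_mult E y x = 0"
        by (subst edge_mult_commute) (auto simp: edge_mult_def not_in_iff)
      then show False using row_sum[OF assms(1) y] d2 by simp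
    qed
    moreover have "finite ?N" using finite_verts by simp
    ultimately have "Max (g ` ?N) \<in> g ` ?N" "\<forall>z\<in>?N. g z \<le> Max (g ` ?N)" by auto
    then show ?thesis by force
  qed
  then obtain top where top: "\<And>y. y \<in> V \<Longrightarrow> top y \<in> V \<and> Upair (top y) y \<in># E"
    "\<And>y z. y \<in> V \<Longrightarrow> z \<in> V \<Longrightarrow> Upair z y \<in># E \<Longrightarrow> g z \<le> g (top y)" by metis
  define M where "M y = g (top y)" for y
  let ?G = "\<Sum>x\<in>V. (g x)\<^sup>2" and ?K = "\<Sum>y\<in>V. (k y)\<^sup>2" and ?D = "\<Sum>y\<in>V. (M y - k y)\<^sup>2"
  have "y \<in> V" if "Upair x y \<in># E" for x y using edges_wf[OF that] by simp
  then have MG: "(1 + \<gamma>) * ?G \<le> (\<Sum>y\<in>V. (M y)\<^sup>2)"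
    using assms(3) g0 supp top(2) by (intro sum_sqr_neighbour_max_ge) (auto simp: M_def)
  have "(M y - k y)\<^sup>2 \<le> (\<Sum>x\<in>V. real (edge_mult E y x) * (g x - k y)\<^sup>2)" if "y \<in> V" for y
  proof -
    \<comment> \<open>A single edge from \<open>y\<close> to a maximising neighbour already
      contributes the whole square.\<close>
    have "1 \<le> real (edge_mult E y (top y))"
      using top(1)[OF that] by (subst edge_mult_commute) (simp add: edge_mult_def Suc_le_eq)
    then have "(M y - k y)\<^sup>2 \<le> real (edge_mult E y (top y)) * (g (top y) - k y)\<^sup>2"
      using mult_right_mono[of 1 _ "(M y - k y)\<^sup>2"] by (simp add: M_def)
    also have "\<dots> \<le> (\<Sum>x\<in>V. real (edge_mult E y x) * (g x - k y)\<^sup>2)"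
      using top(1)[OF that] finite_verts by (intro member_le_sum) auto
    finally show ?thesis .
  qed
  then have "?D \<le> (\<Sum>y\<in>V. \<Sum>x\<in>V. real (edge_mult E y x) * (g x - k y)\<^sup>2)"
    by (rule sum_mono)
  then have DGK: "?D \<le> real d * (?G - ?K)"
    using energy_identity[OF assms(1) Ag] by simp
  have "0 \<le> ?D" by (intro sum_nonneg) auto
  then have "0 \<le> real d * (?G - ?K)" using DGK by linarith
  then have KG: "?K \<le> ?G" using d2 by (auto simp: zero_le_mult_iff)
  have G0: "0 \<le> ?G" by (intro sum_nonneg) auto
  \<comment> \<open>Young's inequality for \<open>M = k + (M - k)\<close>, weighted so that
    \<open>k\<close> uses up only half of the spreading gain \<gamma>; the other half must be paid
    for by \<open>?D\<close>.\<close>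
  have "(M y)\<^sup>2 \<le> (1 + \<gamma>/2) * (k y)\<^sup>2 + (1 + 2/\<gamma>) * (M y - k y)\<^sup>2" for y
  proof -
    have "(1 + \<gamma>/2) * (k y)\<^sup>2 + (1 + 2/\<gamma>) * (M y - k y)\<^sup>2 - (M y)\<^sup>2
        = (\<gamma> * k y - 2 * (M y - k y))\<^sup>2 / (2 * \<gamma>)"
      using assms(2) by (simp add: field_simps power2_eq_square)
    also have "\<dots> \<ge> 0" using assms(2) by simp
    finally show ?thesis by simp
  qed
  then have "(\<Sum>y\<in>V. (M y)\<^sup>2) \<le> (\<Sum>y\<in>V. (1 + \<gamma>/2) * (k y)\<^sup>2 + (1 + 2/\<gamma>) * (M y - k y)\<^sup>2)"
    by (intro sum_mono)
  also have "\<dots> = (1 + \<gamma>/2) * ?K + (1 + 2/\<gamma>) * ?D" by (simp add: sum.distrib sum_distrib_left)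
  also have "\<dots> \<le> (1 + \<gamma>/2) * ?G + (1 + 2/\<gamma>) * ?D"
    using KG assms(2) by simp
  finally have "(\<gamma>/2) * ?G \<le> (1 + 2/\<gamma>) * ?D" using MG by (simp add: algebra_simps)
  then have GD: "\<gamma>\<^sup>2 * ?G \<le> (4 + 2 * \<gamma>) * ?D"
    using assms(2) by (simp add: field_simps power2_eq_square)
  \<comment> \<open>The argument yields the denominator \<open>4 + 2 * \<gamma>\<close>. Passing to
    the required one costs at most a factor 2, which \<open>2 \<le> d\<close> absorbs below.\<close>
  have "2 * \<gamma> \<le> \<gamma>\<^sup>2 + 1" using zero_le_power2[of "\<gamma> - 1"] by (simp add: power2_diff)
  then have poly: "4 + 2 * \<gamma> \<le> 2 * (4 + 2 * \<gamma>\<^sup>2)" using zero_le_power2[of \<gamma>] by argo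
  have "\<gamma>\<^sup>2 * ?G \<le> (4 + 2 * \<gamma>\<^sup>2) * (2 * ?D)"
    using order_trans[OF GD mult_right_mono[OF poly \<open>0 \<le> ?D\<close>]] by (simp only: mult_ac)
  moreover have "4 + 2 * \<gamma>\<^sup>2 > 0" by (simp add: add_pos_nonneg)
  ultimately have "\<gamma>\<^sup>2 / (4 + 2 * \<gamma>\<^sup>2) * ?G \<le> 2 * ?D"
    by (simp add: field_simps)
  also have "\<dots> \<le> real d * ?D" using d2 \<open>0 \<le> ?D\<close> by (intro mult_right_mono) auto
  also have "\<dots> \<le> real d * (real d * (?G - ?K))" using DGK by (intro mult_left_mono) auto
  finally have "\<gamma>\<^sup>2 / (4 + 2 * \<gamma>\<^sup>2) * ?G \<le> (real d)\<^sup>2 * ?G - (real d)\<^sup>2 * ?K"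
    by (simp add: power2_eq_square algebra_simps)
  moreover have "(\<Sum>y\<in>V. (adj_op g y)\<^sup>2) = (real d)\<^sup>2 * ?K"
    by (simp add: Ag power_mult_distrib sum_distrib_left)
  ultimately show ?thesis by (simp add: left_diff_distrib)
qed

lemma eigenvalue_bound_small_support:
  assumes "regular V E d" "\<gamma> > 0" "spreader V E \<gamma>" "2 \<le> card V"
    and f: "\<And>u. u \<in> V \<Longrightarrow> adj_op f u = \<mu> * f u"
    and "u \<in> V" "0 < f u" and supp: "2 * card {x\<in>V. 0 < f x} \<le> card V"
  shows "\<mu>\<^sup>2 \<le> (real d)\<^sup>2 - \<gamma>\<^sup>2 / (4 + 2 * \<gamma>\<^sup>2)"
proof -
  define g where "g x = max (f x) 0" for x
  have g: "0 \<le> g x" "f x \<le> g x" "g x * f x = (g x)\<^sup>2" for x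
    by (auto simp: g_def max_def power2_eq_square)
  \<comment> \<open>Applying the operator twice makes the sign of \<mu> irrelevant: for negative
    \<mu>, the bound \<open>adj_op g x \<ge> \<mu> * f x\<close> says nothing where \<open>f\<close>
    is positive.\<close>
  have "\<mu>\<^sup>2 * f x \<le> adj_op (adj_op g) x" if x: "x \<in> V" for x
  proof -
    have "\<mu>\<^sup>2 * f x = \<mu> * adj_op f x" using f[OF x] by (simp add: power2_eq_square)
    also have "\<dots> = adj_op (adj_op f) x" using f by (simp add: sum_distrib_left mult_ac)
    also have "\<dots> \<le> adj_op (adj_op g) x" using g by (intro adj_op_mono)
    finally show ?thesis .
  qed
  then have "(\<Sum>x\<in>V. g x * (\<mu>\<^sup>2 * f x)) \<le> (\<Sum>x\<in>V. g x * adj_op (adj_op g) x)"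
    using g by (intro sum_mono mult_left_mono)
  moreover have "(\<Sum>x\<in>V. g x * (\<mu>\<^sup>2 * f x)) = \<mu>\<^sup>2 * (\<Sum>x\<in>V. (g x)\<^sup>2)"
    by (simp add: sum_distrib_left mult.left_commute[of _ "\<mu>\<^sup>2"] g)
  moreover have "(\<Sum>x\<in>V. g x * adj_op (adj_op g) x) = (\<Sum>x\<in>V. (adj_op g x)\<^sup>2)"
    by (subst adj_op_symmetric) (simp add: power2_eq_square)
  moreover have "{x\<in>V. 0 < g x} = {x\<in>V. 0 < f x}" by (auto simp: g_def)
  ultimately have "\<mu>\<^sup>2 * (\<Sum>x\<in>V. (g x)\<^sup>2) \<le> ((real d)\<^sup>2 - \<gamma>\<^sup>2 / (4 + 2 * \<gamma>\<^sup>2)) * (\<Sum>x\<in>V. (g x)\<^sup>2)"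
    using adj_op_contraction[OF assms(1-4), of g] g supp by simp
  moreover have "0 < (\<Sum>x\<in>V. (g x)\<^sup>2)"
    using assms finite_verts by (intro sum_pos2[of _ u]) (auto simp: g_def)
  ultimately show ?thesis by simp
qed

text \<open>Both \<open>f\<close> and its negative are eigenfunctions, with disjoint positive
  supports, so one of these covers at most half of the vertices. Vanishing sum ensures that neither
  is empty.\<close>

lemma eigenvalue_bound:
  assumes "regular V E d" "\<gamma> > 0" "spreader V E \<gamma>" "2 \<le> card V"
    and f: "\<And>u. u \<in> V \<Longrightarrow> adj_op f u = \<mu> * f u"
    and "sum f V = 0" "u \<in> V" "f u \<noteq> 0"
  shows "\<mu>\<^sup>2 \<le> (real d)\<^sup>2 - \<gamma>\<^sup>2 / (4 + 2 * \<gamma>\<^sup>2)"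
proof -
  have sign_change: "\<exists>u\<in>V. 0 < h u" if "sum h V = 0" "u \<in> V" "h u < 0" for h :: "'a \<Rightarrow> real" and u
  proof (rule ccontr)
    assume "\<not> ?thesis"
    then have "\<forall>x\<in>V. 0 \<le> - h x" by (auto simp: not_less)
    then have "0 < (\<Sum>x\<in>V. - h x)" using that finite_verts by (intro sum_pos2[of _ u]) auto
    then show False using that by (simp add: sum_negf)
  qed
  have pos: "\<exists>u\<in>V. 0 < f u" and neg: "\<exists>u\<in>V. 0 < - f u"
    using sign_change[of f u] sign_change[of "\<lambda>x. - f x" u] assms(6-8)
    by (cases "0 < f u"; force simp: sum_negf)+
  have "card {x\<in>V. 0 < f x} + card {x\<in>V. 0 < - f x} \<le> card V"
    using finite_verts by (subst card_Un_disjoint[symmetric]) (auto intro: card_mono)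
  then consider "2 * card {x\<in>V. 0 < f x} \<le> card V" | "2 * card {x\<in>V. 0 < - f x} \<le> card V"
    by linarith
  then show ?thesis
  proof cases
    case 1 then show ?thesis
      using pos eigenvalue_bound_small_support[OF assms(1-4) f] by blast
  next
    case 2
    have "adj_op (\<lambda>x. - f x) u = \<mu> * - f u" if "u \<in> V" for u
      using f[OF that] by (simp add: sum_negf)
    then show ?thesis
      using 2 neg eigenvalue_bound_small_support[OF assms(1-4), of "\<lambda>x. - f x"] by blast
  qed
qed

end

section \<open>Spectra of real symmetric matrices\<close>

text \<open>The Hermitian form \<open>q\<close> of an eigenvector is its own conjugate and equals
  \<open>a * N\<close>, where \<open>N\<close> is the squared norm, real and nonzero.\<close>

lemma real_symmetric_eigenvalue_real:
  fixes A :: "real mat"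
  assumes A: "A \<in> carrier_mat n n" "A\<^sup>T = A"
    and "eigenvalue (map_mat complex_of_real A) a"
  shows "a \<in> \<real>"
proof -
  let ?C = "map_mat complex_of_real A"
  obtain v where v: "v \<in> carrier_vec n" "v \<noteq> 0\<^sub>v n" "?C *\<^sub>v v = a \<cdot>\<^sub>v v"
    using assms by (auto simp: eigenvalue_def eigenvector_def)
  have sym: "A $$ (i, j) = A $$ (j, i)" if "i < n" "j < n" for i j
    using A that by (metis carrier_matD index_transpose_mat(1))
  have ev: "(\<Sum>j<n. complex_of_real (A $$ (i, j)) * v $ j) = a * v $ i" if "i < n" for i
  proof -
    have "(?C *\<^sub>v v) $ i = (\<Sum>j<n. complex_of_real (A $$ (i, j)) * v $ j)"
      using A v(1) that by (auto simp: scalar_prod_def lessThan_atLeast0 intro!: sum.cong)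
    then show ?thesis using v that by simp
  qed
  define N q where "N = (\<Sum>i<n. cnj (v $ i) * v $ i)"
    and "q = (\<Sum>i<n. \<Sum>j<n. cnj (v $ i) * complex_of_real (A $$ (i, j)) * v $ j)"
  have "q = (\<Sum>i<n. cnj (v $ i) * (a * v $ i))"
    by (simp add: q_def sum_distrib_left mult.assoc flip: ev)
  then have qN: "q = a * N" by (simp add: N_def sum_distrib_left mult_ac)
  have "cnj q = (\<Sum>i<n. \<Sum>j<n. cnj (v $ j) * complex_of_real (A $$ (i, j)) * v $ i)"
    by (simp add: q_def mult_ac)
  also have "\<dots> = (\<Sum>i<n. \<Sum>j<n. cnj (v $ j) * complex_of_real (A $$ (j, i)) * v $ i)"
    using sym by (intro sum.cong refl) simp
  also have "\<dots> = q" unfolding q_def by (rule sum.swap)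
  finally have qcnj: "cnj q = q" .
  have Ncnj: "cnj N = N" by (simp add: N_def mult.commute)
  obtain i where i: "i < n" "v $ i \<noteq> 0" using v(1,2) by (auto simp: vec_eq_iff)
  have "N = complex_of_real (\<Sum>i<n. (cmod (v $ i))\<^sup>2)"
    by (simp add: N_def mult.commute[of "cnj _"] complex_norm_square del: of_real_power)
  moreover have "0 < (\<Sum>i<n. (cmod (v $ i))\<^sup>2)"
    using i by (intro sum_pos2[of _ i]) auto
  ultimately have "N \<noteq> 0" by (metis less_irrefl of_real_eq_0_iff)
  then have "cnj a = a" using qcnj qN Ncnj by simp
  then show ?thesis by (simp add: Reals_cnj_iff)
qed

text \<open>The complex linear factors have real roots, so the factorization is the image of a real
  one and descends by injectivity of the embedding.\<close>

lemma real_symmetric_char_poly_splits: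
  fixes A :: "real mat"
  assumes A: "A \<in> carrier_mat n n" "A\<^sup>T = A"
  shows "\<exists>es. char_poly A = (\<Prod>e\<leftarrow>es. [:- e, 1:]) \<and> length es = n"
proof -
  let ?C = "map_mat complex_of_real A"
  interpret h: map_poly_inj_idom_hom complex_of_real ..
  have C: "?C \<in> carrier_mat n n" using A by simp
  then obtain as where as: "char_poly ?C = (\<Prod>a\<leftarrow>as. [:- a, 1:])" "length as = n"
    using char_poly_factorized by blast
  have real: "complex_of_real (Re a) = a" if "a \<in> set as" for a
  proof -
    have "poly (char_poly ?C) a = 0"
      using that by (force simp: as(1) poly_prod_list prod_list_zero_iff)
    then have "eigenvalue ?C a" using eigenvalue_root_char_poly[OF C] by simp
    then show ?thesis using real_symmetric_eigenvalue_real[OF A] by simp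
  qed
  have "char_poly ?C = map_poly complex_of_real (char_poly A)"
    by (rule of_real_hom.char_poly_hom[OF A(1)])
  then have "map_poly complex_of_real (char_poly A) = (\<Prod>a\<leftarrow>as. [:- a, 1:])"
    using as(1) by simp
  also have "\<dots> = (\<Prod>a\<leftarrow>as. map_poly complex_of_real [:- Re a, 1:])"
    using real by (intro arg_cong[of _ _ prod_list] map_cong) auto
  also have "\<dots> = map_poly complex_of_real (\<Prod>a\<leftarrow>as. [:- Re a, 1:])"
    by (simp add: h.hom_prod_list o_def)
  finally have "char_poly A = (\<Prod>a\<leftarrow>as. [:- Re a, 1:])" by simp
  then show ?thesis using as(2) by (intro exI[of _ "map Re as"]) (simp add: o_def)
qed

lemma proots_prod_linear_factors:
  "proots (\<Prod>e\<leftarrow>es. [:- e, 1:]) = mset (es :: 'a :: idom list)"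
proof (induction es)
  case (Cons e es)
  have "(\<Prod>e\<leftarrow>es. [:- e, 1:]) \<noteq> 0" by (auto simp: prod_list_zero_iff)
  then show ?case using Cons by (simp add: proots_mult del: mult_pCons_left)
qed simp

text \<open>The leading 2 by 2 block of a Schur form is triangular with diagonal
  \<open>e, e\<close>. Symmetry of \<open>A\<close> kills its corner entry \<open>b\<close>, so the
  first two columns of \<open>P\<close> are independent eigenvectors, and some nonzero combination
  is orthogonal to \<open>w\<close>.\<close>

lemma real_symmetric_multiple_eigenvalue:
  fixes A :: "real mat"
  assumes A: "A \<in> carrier_mat n n" "A\<^sup>T = A"
    and cp: "char_poly A = (\<Prod>x\<leftarrow>e # e # es. [:- x, 1:])"
    and w: "w \<in> carrier_vec n"
  shows "\<exists>v. eigenvector A v e \<and> w \<bullet> v = 0"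
proof -
  obtain B P Q where "schur_decomposition A (e # e # es) = (B, P, Q)" using prod_cases3 by blast
  then have sim: "similar_mat_wit A B P Q" and ut: "upper_triangular B" and diag: "diag_mat B = e # e # es"
    using schur_decomposition[OF A(1) cp] by auto
  note m = similar_mat_witD2[OF A(1) sim]
  have "length (diag_mat B) = n" using m(5) by (simp add: diag_mat_def)
  then have n2: "2 \<le> n" using diag by simp
  have diag_nth: "B $$ (i, i) = (e # e # es) ! i" if "i < n" for i
    using that m(5) unfolding diag[symmetric] by (simp add: diag_mat_def)
  have B: "B $$ (0, 0) = e" "B $$ (1, 1) = e" using diag_nth[of 0] diag_nth[of 1] n2 by auto
  have below: "B $$ (i, j) = 0" if "i < n" "j < i" for i j
    using ut that m(5) by (auto simp: upper_triangular_def)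
  define b where "b = B $$ (0, 1)"
  define p0 p1 where "p0 = col P 0" and "p1 = col P 1"
  have p[simp]: "p0 \<in> carrier_vec n" "p1 \<in> carrier_vec n" using m(6) n2 by (auto simp: p0_def p1_def)
  have AP: "A * P = P * B"
  proof -
    have "A * P = P * B * (Q * P)"
      unfolding m(3) using m(5-7) by (simp add: assoc_mult_mat[of _ n n _ n _ n])
    then show ?thesis using m by simp
  qed
  have Acol: "A *\<^sub>v col P j = P *\<^sub>v col B j" if "j < n" for j
    using AP that A(1) m(5,6) by (metis col_mult2)
  have Punit: "P *\<^sub>v unit_vec n j = col P j" if "j < n" for j
    using that m(6) by (intro eq_vecI) auto
  have Pcol: "P *\<^sub>v (x \<cdot>\<^sub>v unit_vec n 0 + y \<cdot>\<^sub>v unit_vec n 1) = x \<cdot>\<^sub>v p0 + y \<cdot>\<^sub>v p1" for x y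
    using m(6) n2 by (simp add: mult_add_distrib_mat_vec[of _ n n] mult_mat_vec[of _ n n]
        Punit p0_def p1_def)
  have "col B 0 = e \<cdot>\<^sub>v unit_vec n 0 + 0 \<cdot>\<^sub>v unit_vec n 1"
    using m(5) n2 B below by (intro eq_vecI) auto
  then have "A *\<^sub>v p0 = e \<cdot>\<^sub>v p0 + 0 \<cdot>\<^sub>v p1" using Acol[of 0] n2 Pcol by (simp add: p0_def)
  moreover have "e \<cdot>\<^sub>v p0 + 0 \<cdot>\<^sub>v p1 = e \<cdot>\<^sub>v p0"
    by (intro eq_vecI) (simp_all add: carrier_vecD[OF p(1)] carrier_vecD[OF p(2)])
  ultimately have A0: "A *\<^sub>v p0 = e \<cdot>\<^sub>v p0" by simp
  have "col B 1 = b \<cdot>\<^sub>v unit_vec n 0 + e \<cdot>\<^sub>v unit_vec n 1"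
    using m(5) n2 B below by (intro eq_vecI) (auto simp: b_def)
  then have A1: "A *\<^sub>v p1 = b \<cdot>\<^sub>v p0 + e \<cdot>\<^sub>v p1" using Acol[of 1] n2 Pcol by (simp add: p1_def)
  have Qp: "Q *\<^sub>v col P j = unit_vec n j" if "j < n" for j
    using m(2,6,7) that by (metis col_mult2 col_one)
  have Q0: "Q *\<^sub>v p0 = unit_vec n 0" and Q1: "Q *\<^sub>v p1 = unit_vec n 1"
    using Qp n2 by (auto simp: p0_def p1_def)
  have p0_nz: "p0 \<noteq> 0\<^sub>v n"
  proof
    assume "p0 = 0\<^sub>v n"
    then have "Q *\<^sub>v p0 = 0\<^sub>v n" using m(7) by auto
    then have "unit_vec n 0 $ 0 = (0\<^sub>v n $ 0 :: real)" using Q0 by simp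
    then show False using n2 by simp
  qed
  \<comment> \<open>Both sides contain \<open>e * (p0 \<bullet> p1)\<close>; what remains is
    \<open>b * (p0 \<bullet> p0)\<close>.\<close>
  have "p0 \<bullet> (A *\<^sub>v p1) = (A *\<^sub>v p0) \<bullet> p1"
    using A p by (metis transpose_vec_mult_scalar)
  then have "b * (p0 \<bullet> p0) = 0"
    using p by (simp add: A0 A1 scalar_prod_add_distrib[of _ n])
  moreover have "p0 \<bullet> p0 \<noteq> 0" using p0_nz p conjugate_square_eq_0_vec[of p0 n] by simp
  ultimately have "b = 0" by simp
  moreover have "0 \<cdot>\<^sub>v p0 + e \<cdot>\<^sub>v p1 = e \<cdot>\<^sub>v p1"
    by (intro eq_vecI) (simp_all add: carrier_vecD[OF p(1)] carrier_vecD[OF p(2)])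
  ultimately have A1: "A *\<^sub>v p1 = e \<cdot>\<^sub>v p1" using A1 by simp
  show ?thesis
  proof (cases "w \<bullet> p0 = 0")
    case True
    then show ?thesis using A0 p0_nz A(1) by (intro exI[of _ p0]) (auto simp: eigenvector_def)
  next
    case False
    define v where "v = (w \<bullet> p1) \<cdot>\<^sub>v p0 + (- (w \<bullet> p0)) \<cdot>\<^sub>v p1"
    have v: "v \<in> carrier_vec n" by (simp add: v_def)
    \<comment> \<open>\<open>Q\<close> inverts \<open>P\<close> and so reads off coordinates in the
      columns of \<open>P\<close>; the second coordinate of \<open>v\<close> is nonzero in this
      case.\<close>
    have "Q *\<^sub>v v = (w \<bullet> p1) \<cdot>\<^sub>v unit_vec n 0 + (- (w \<bullet> p0)) \<cdot>\<^sub>v unit_vec n 1"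
      using m(7) by (simp add: v_def mult_add_distrib_mat_vec[of _ n n] mult_mat_vec[of _ n n] Q0 Q1)
    then have "(Q *\<^sub>v v) $ 1 \<noteq> 0" using n2 False by simp
    then have "v \<noteq> 0\<^sub>v n" using m(7) n2 by auto
    moreover have "A *\<^sub>v v = e \<cdot>\<^sub>v v"
    proof -
      have "A *\<^sub>v v = (w \<bullet> p1) \<cdot>\<^sub>v (e \<cdot>\<^sub>v p0) + (- (w \<bullet> p0)) \<cdot>\<^sub>v (e \<cdot>\<^sub>v p1)"
        using A(1) by (simp add: v_def mult_add_distrib_mat_vec[of _ n n] mult_mat_vec[of _ n n] A0 A1)
      also have "\<dots> = e \<cdot>\<^sub>v v"
        by (intro eq_vecI)
          (simp_all add: v_def carrier_vecD[OF p(1)] carrier_vecD[OF p(2)] algebra_simps)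
      finally show ?thesis .
    qed
    moreover have "w \<bullet> v = 0"
      using w by (simp add: v_def scalar_prod_add_distrib[of _ n])
    ultimately show ?thesis using v A(1) by (auto simp: eigenvector_def)
  qed
qed

section \<open>Eigenvalues of the graph and the final bound\<close>

context multigraph
begin

lemma vertex_list: "distinct (vertex_list V)" "set (vertex_list V) = V"
  using someI_ex[of "\<lambda>vs. distinct vs \<and> set vs = V"] finite_distinct_list[OF finite_verts]
  by (auto simp: vertex_list_def)

lemma bij_betw_vertex_list: "bij_betw ((!) (vertex_list V)) {..<card V} V"
  using bij_betw_nth[of "vertex_list V"] vertex_list distinct_card[of "vertex_list V"] by auto

lemma adj_matrix_carrier: "adj_matrix V E \<in> carrier_mat (card V) (card V)"
  by (simp add: adj_matrix_def)

lemma adj_matrix_symmetric: "(adj_matrix V E)\<^sup>T = adj_matrix V E"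
  by (intro eq_matI) (auto simp: adj_matrix_def edge_mult_commute)

text \<open>Since the polynomial splits over the reals, its real roots exhaust its degree, so the
  sorted list from the definition loses no eigenvalue.\<close>

lemma char_poly_adj_matrix:
  "char_poly (adj_matrix V E) = (\<Prod>e\<leftarrow>adj_eigenvalues V E. [:- e, 1:])"
  and length_adj_eigenvalues: "length (adj_eigenvalues V E) = card V"
  and sorted_adj_eigenvalues: "sorted_wrt (\<ge>) (adj_eigenvalues V E)"
proof -
  obtain es where es: "char_poly (adj_matrix V E) = (\<Prod>e\<leftarrow>es. [:- e, 1:])" "length es = card V"
    using real_symmetric_char_poly_splits[OF adj_matrix_carrier adj_matrix_symmetric] by blast
  then have "adj_eigenvalues V E = rev (sort es)"
    by (simp add: adj_eigenvalues_def proots_prod_linear_factors)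
  then have perm: "mset (adj_eigenvalues V E) = mset es" and "sorted (rev (adj_eigenvalues V E))"
    by simp_all
  then show "sorted_wrt (\<ge>) (adj_eigenvalues V E)" by (simp add: sorted_wrt_rev)
  show "length (adj_eigenvalues V E) = card V" using perm es(2) by (metis size_mset)
  have "(\<Prod>e\<leftarrow>xs. [:- e, 1:]) = (\<Prod>e\<in>#mset xs. [:- e, 1:])" for xs :: "real list"
    by (simp flip: prod_mset_prod_list)
  then show "char_poly (adj_matrix V E) = (\<Prod>e\<leftarrow>adj_eigenvalues V E. [:- e, 1:])"
    using perm es(1) by simp
qed

text \<open>Carries vectors over indices to functions on vertices. The statement on sums lets
  orthogonality to the all-ones vector become \<open>sum f V = 0\<close>.\<close>

lemma eigenvector_imp_eigenfunction:
  assumes "eigenvector (adj_matrix V E) x e"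
  obtains f u where "\<And>u. u \<in> V \<Longrightarrow> adj_op f u = e * f u" "u \<in> V" "f u \<noteq> 0"
    "sum f V = (\<Sum>i<card V. x $ i)"
proof -
  let ?vs = "vertex_list V"
  have x: "x \<in> carrier_vec (card V)" "x \<noteq> 0\<^sub>v (card V)" "adj_matrix V E *\<^sub>v x = e \<cdot>\<^sub>v x"
    using assms adj_matrix_carrier by (auto simp: eigenvector_def)
  define f where "f u = x $ (inv_into {..<card V} ((!) ?vs) u)" for u
  have f_nth: "f (?vs ! i) = x $ i" if "i < card V" for i
    using bij_betw_inv_into_left[OF bij_betw_vertex_list] that by (simp add: f_def)
  have reindex: "(\<Sum>v\<in>V. F v) = (\<Sum>i<card V. F (?vs ! i))" for F :: "'a \<Rightarrow> real"
    by (rule sum.reindex_bij_betw[OF bij_betw_vertex_list, symmetric])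
  have nth: "\<exists>i<card V. u = ?vs ! i" if "u \<in> V" for u
    using bij_betw_vertex_list that by (auto simp: bij_betw_def)
  have "adj_op f u = e * f u" if "u \<in> V" for u
  proof -
    obtain i where i: "i < card V" "u = ?vs ! i" using nth[OF \<open>u \<in> V\<close>] by blast
    have "(adj_matrix V E *\<^sub>v x) $ i = adj_op f u"
      unfolding reindex using i x(1)
      by (auto simp: adj_matrix_def scalar_prod_def f_nth lessThan_atLeast0 intro!: sum.cong)
    then show ?thesis using x i f_nth by simp
  qed
  moreover obtain i where "i < card V" "x $ i \<noteq> 0" using x(1,2) by (auto simp: vec_eq_iff)
  moreover have "?vs ! i \<in> V" if "i < card V" for i
    using bij_betw_vertex_list that by (auto simp: bij_betw_def)
  moreover have "sum f V = (\<Sum>i<card V. x $ i)" by (simp add: reindex f_nth)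
  ultimately show ?thesis using that f_nth by metis
qed

text \<open>The constants are an eigenfunction for \<open>d\<close>, so by symmetry an eigenfunction
  for any other eigenvalue has sum zero.\<close>

lemma nonprincipal_eigenvalue_bound:
  assumes "regular V E d" "\<gamma> > 0" "spreader V E \<gamma>" "2 \<le> card V"
    and e: "e \<in> set (adj_eigenvalues V E)" "e \<noteq> real d"
  shows "e\<^sup>2 \<le> (real d)\<^sup>2 - \<gamma>\<^sup>2 / (4 + 2 * \<gamma>\<^sup>2)"
proof -
  have "poly (char_poly (adj_matrix V E)) e = 0"
    using e by (force simp: char_poly_adj_matrix poly_prod_list prod_list_zero_iff)
  then obtain x where "eigenvector (adj_matrix V E) x e"
    using eigenvalue_root_char_poly[OF adj_matrix_carrier] by (auto simp: eigenvalue_def)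
  then obtain f u where f: "\<And>u. u \<in> V \<Longrightarrow> adj_op f u = e * f u" "u \<in> V" "f u \<noteq> 0"
    using eigenvector_imp_eigenfunction by metis
  have "e * sum f V = (\<Sum>u\<in>V. 1 * adj_op f u)" by (simp add: sum_distrib_left f)
  also have "\<dots> = (\<Sum>u\<in>V. adj_op (\<lambda>_. 1) u * f u)" by (rule adj_op_symmetric)
  also have "\<dots> = real d * sum f V" using row_sum[OF assms(1)] by (simp add: sum_distrib_left)
  finally have "sum f V = 0" using e(2) by simp
  then show ?thesis using eigenvalue_bound[OF assms(1-4) f(1)] f(2,3) by blast
qed

end

theorem theorem12p2:
  fixes V :: "'a set" and E :: "'a uprod multiset" and n d i :: nat and \<gamma> :: real
  assumes "multigraph V E"
    and "card V = n"
    and "regular V E d"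
    and "\<gamma> > 0"
    and "spreader V E \<gamma>"
    and "1 < i" and "i \<le> n"
  shows "(adj_eigenvalue V E i)\<^sup>2 \<le> (real d)\<^sup>2 - \<gamma>\<^sup>2 / (4 + 2 * \<gamma>\<^sup>2)"
proof -
  interpret multigraph V E by (rule assms(1))
  let ?L = "adj_eigenvalues V E"
  have n2: "2 \<le> card V" using assms by simp
  note hyps = assms(3-5) n2
  have len: "length ?L = card V" by (rule length_adj_eigenvalues)
  have anti: "?L ! j \<ge> ?L ! k" if "j \<le> k" "k < card V" for j k
    using sorted_wrt_nth_less[OF sorted_adj_eigenvalues, of j k] that len by (cases "j = k") auto
  show ?thesis
  proof (cases "?L ! (i - 1) = real d")
    case False
    then show ?thesis
      using nonprincipal_eigenvalue_bound[OF hyps, of "?L ! (i - 1)"] assms len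
      by (simp add: adj_eigenvalue_def)
  next
    case True
    have "?L ! 1 \<ge> real d" "?L ! 0 \<ge> ?L ! 1"
      using anti[of 1 "i - 1"] anti[of 0 1] True assms by auto
    \<comment> \<open>An eigenvalue above \<open>d\<close> would differ from \<open>d\<close>, so
      its square would lie strictly below that of \<open>d\<close>.\<close>
    moreover have "?L ! j = real d" if "?L ! j \<ge> real d" "j < 2" for j
    proof (rule ccontr)
      assume "?L ! j \<noteq> real d"
      then have "(?L ! j)\<^sup>2 \<le> (real d)\<^sup>2 - \<gamma>\<^sup>2 / (4 + 2 * \<gamma>\<^sup>2)"
        using nonprincipal_eigenvalue_bound[OF hyps, of "?L ! j"] that len n2 by simp
      moreover have "(real d)\<^sup>2 \<le> (?L ! j)\<^sup>2" using that by (intro power_mono) auto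
      moreover have "0 < \<gamma>\<^sup>2 / (4 + 2 * \<gamma>\<^sup>2)"
        using assms(4) by (intro divide_pos_pos) (auto intro: add_pos_nonneg)
      ultimately show False by linarith
    qed
    ultimately have "?L ! 0 = real d" "?L ! 1 = real d" by auto
    then have "?L = real d # real d # drop 2 ?L"
      using len n2 by (cases ?L; cases "tl ?L") auto
    then have cp: "char_poly (adj_matrix V E) = (\<Prod>x\<leftarrow>real d # real d # drop 2 ?L. [:- x, 1:])"
      using char_poly_adj_matrix by metis
    obtain x where x: "eigenvector (adj_matrix V E) x (real d)" "vec (card V) (\<lambda>_. 1) \<bullet> x = 0"
      using real_symmetric_multiple_eigenvalue[OF adj_matrix_carrier adj_matrix_symmetric cp,
          of "vec (card V) (\<lambda>_. 1)"] by auto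
    then have "dim_vec x = card V" using adj_matrix_carrier by (auto simp: eigenvector_def)
    then have "(\<Sum>i<card V. x $ i) = 0"
      using x(2) by (simp add: scalar_prod_def lessThan_atLeast0)
    then obtain f u where "\<And>u. u \<in> V \<Longrightarrow> adj_op f u = real d * f u" "u \<in> V" "f u \<noteq> 0" "sum f V = 0"
      using eigenvector_imp_eigenfunction[OF x(1)] by metis
    \<comment> \<open>Impossible for positive \<gamma>, but it is literally the claim when the
      eigenvalue is \<open>d\<close>, so no contradiction need be drawn.\<close>
    then have "(real d)\<^sup>2 \<le> (real d)\<^sup>2 - \<gamma>\<^sup>2 / (4 + 2 * \<gamma>\<^sup>2)"
      using eigenvalue_bound[OF hyps] by blast
    then show ?thesis using True by (simp add: adj_eigenvalue_def)
  qed
qed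

end
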